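(* Let $\tau>0$, let $\{A(t)\}_{t\in\mathbb{R}}$ satisfy the Acquistapace–Terreni conditions on $\mathbb{R}$ with associated evolution family $U(t,s)$, suppose $(t,s)\mapsto U(t,s)x$ is Bi-almost automorphic uniformly for $x$ in bounded subsets of $\mathbb{X}$, and suppose $\|U(t,s)\|\le Me^{-\delta(t-s)}$ for $t\ge s$ with constants $M,\delta>0$. Suppose that $f\in AA(\mathbb{R}\times\mathbb{X};\mathbb{X})$ is $L_f$-Lipschitz (in the second variable, uniformly in the first). Let $\rho>0$ and $\Delta_0=\{x\in AA(\mathbb{R};\mathbb{X}):\|x-x_0\|_\infty\le\rho\}$, where $x_0(t)=\int_{-\infty}^tU(t,s)f(s,0)\,ds$, and let $$\Gamma x(t)=\int_{-\infty}^tU(t,s)f(s,x(s-\tau))\,ds .$$ Suppose that $$0<\theta=\Big(1-\frac{M}{\delta}L_f\Big)^{-1}\|\Gamma x_0-x_0\|_\infty\le\rho .$$ Then the equation $$x'(t)=A(t)x(t)+f(t,x(t-\tau)),\quad t\in\mathbb{R},$$ has a unique mild solution $x\in AA(\mathbb{R};\mathbb{X})$ such that $\|x-x_0\|_\infty\le\rho$.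
   Context: $\mathbb{X}$ is a Banach space; $\|\cdot\|_\infty$ is the supremum norm. $AA(\mathbb{R};\mathbb{X})$ (almost automorphic functions): bounded continuous $f:\mathbb{R}\to\mathbb{X}$ such that every real sequence has a subsequence $(s_n)$ and a function $\tilde f$ with $\lim_nf(t+s_n)=\tilde f(t)$, $\lim_n\tilde f(t-s_n)=f(t)$ for each $t$. $AA(\mathbb{R}\times\mathbb{X};\mathbb{X})$: bounded continuous $f:\mathbb{R}\times\mathbb{X}\to\mathbb{X}$ such that for every bounded $\mathcal{D}\subset\mathbb{X}$ and every real sequence there are a subsequence $(s_n)$ and $\tilde f$ with $\lim_nf(t+s_n,x)=\tilde f(t,x)$, $\lim_n\tilde f(t-s_n,x)=f(t,x)$, pointwise in $t$, uniformly for $x\in\mathcal{D}$. Acquistapace–Terreni conditions on $\mathbb{R}$: $A(t):D(A(t))\subset\mathbb{X}\to\mathbb{X}$ are linear and there are constants $\lambda_0\ge0$, $\theta\in(\pi/2,\pi)$ (unrelated to the $\theta$ of the claim), $K_1,K_2\ge0$, $\beta_1,\beta_2\in(0,1]$ with $\beta_1+\beta_2>1$ such that for $t,s\in\mathbb{R}$ and $\lambda\in\Sigma_\theta=\{\lambda\in\mathbb{C}\setminus\{0\}:|\arg\lambda|\le\theta\}$: $\Sigma_\theta\cup\{0\}\subset\rho(A(t)-\lambda_0)$, $\|R(\lambda,A(t)-\lambda_0)\|\le\frac{K_1}{1+|\lambda|}$, and $\|(A(t)-\lambda_0)R(\lambda,A(t)-\lambda_0)[R(\lambda_0,A(t))-R(\lambda_0,A(s))]\|\le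 K_2|t-s|^{\beta_1}|\lambda|^{-\beta_2}$. Under these there is a unique evolution family $U(t,s)$, $t\ge s$ in $\mathbb{R}$, governing $x'(t)=A(t)x(t)$: bounded operators with $U(t,t)=I$, $U(t,s)U(s,r)=U(t,r)$ for $t\ge s\ge r$, strongly continuous in $(t,s)$. $(t,s)\mapsto U(t,s)x$ Bi-almost automorphic uniformly on bounded sets: it is jointly continuous and for every real sequence and every bounded $\mathcal{D}\subset\mathbb{X}$ there is a subsequence $(s_n)$ with $\tilde U(t,s)x:=\lim_nU(t+s_n,s+s_n)x$ existing and $\lim_n\tilde U(t-s_n,s-s_n)x=U(t,s)x$ for each $t\ge s$, uniformly for $x\in\mathcal{D}$. Mild solution: a continuous $x:\mathbb{R}\to\mathbb{X}$ with $x(t)=U(t,a)x(a)+\int_a^tU(t,s)f(s,x(s-\tau))\,ds$ for all $t\ge a$ in $\mathbb{R}$. *)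

theory Defs
  imports "HOL-Analysis.Analysis"
begin

section \<open>Complex Banach spaces and unbounded operators\<close>

text \<open>The resolvents below have complex spectral parameters, so the state space is a complex
  Banach space; its real scaling is the restriction of the complex one.\<close>

class complex_banach = banach +
  fixes scaleC :: "complex \<Rightarrow> 'a \<Rightarrow> 'a"  (infixr \<open>*\<^sub>C\<close> 75)
  assumes scaleC_add_right: "c *\<^sub>C (x + y) = c *\<^sub>C x + c *\<^sub>C y"
    and scaleC_add_left: "(c + d) *\<^sub>C x = c *\<^sub>C x + d *\<^sub>C x"
    and scaleC_scaleC: "c *\<^sub>C (d *\<^sub>C x) = (c * d) *\<^sub>C x"
    and scaleC_of_real: "complex_of_real r *\<^sub>C x = r *\<^sub>R x"
    and norm_scaleC: "norm (c *\<^sub>C x) = cmod c * norm x"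

definition bounded_clinear :: "('a::complex_banach \<Rightarrow> 'a) \<Rightarrow> bool" where
  "bounded_clinear T \<longleftrightarrow> bounded_linear T \<and> (\<forall>c x. T (c *\<^sub>C x) = c *\<^sub>C T x)"

text \<open>An unbounded operator is given by its domain \<open>D\<close> and a total function \<open>A\<close>, of which only the
  values on \<open>D\<close> matter.\<close>

definition clinear_operator :: "'a::complex_banach set \<Rightarrow> ('a \<Rightarrow> 'a) \<Rightarrow> bool" where
  "clinear_operator D A \<longleftrightarrow>
     0 \<in> D \<and>
     (\<forall>x\<in>D. \<forall>y\<in>D. x + y \<in> D \<and> A (x + y) = A x + A y) \<and>
     (\<forall>c. \<forall>x\<in>D. c *\<^sub>C x \<in> D \<and> A (c *\<^sub>C x) = c *\<^sub>C A x)"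

text \<open>The convention is \<open>R(\<lambda>, A) = (\<lambda> - A)\<^sup>-\<^sup>1\<close>.\<close>

definition resolvent :: "'a::complex_banach set \<Rightarrow> ('a \<Rightarrow> 'a) \<Rightarrow> complex \<Rightarrow> 'a \<Rightarrow> 'a" where
  "resolvent D A z = inv_into D (\<lambda>x. z *\<^sub>C x - A x)"

definition resolvent_set :: "'a::complex_banach set \<Rightarrow> ('a \<Rightarrow> 'a) \<Rightarrow> complex set" where
  "resolvent_set D A =
     {z. bij_betw (\<lambda>x. z *\<^sub>C x - A x) D UNIV \<and> bounded_clinear (resolvent D A z)}"

definition shift_op :: "('a::complex_banach \<Rightarrow> 'a) \<Rightarrow> real \<Rightarrow> 'a \<Rightarrow> 'a" where
  "shift_op A l x = A x - l *\<^sub>R x"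

section \<open>The Acquistapace--Terreni conditions and evolution families\<close>

definition sector :: "real \<Rightarrow> complex set" where
  "sector \<phi> = {z. z \<noteq> 0 \<and> \<bar>Arg z\<bar> \<le> \<phi>}"

definition acquistapace_terreni ::
    "(real \<Rightarrow> 'a::complex_banach set) \<Rightarrow> (real \<Rightarrow> 'a \<Rightarrow> 'a) \<Rightarrow> bool" where
  "acquistapace_terreni D A \<longleftrightarrow>
     (\<forall>t. clinear_operator (D t) (A t)) \<and>
     (\<exists>\<omega> \<phi> K\<^sub>1 K\<^sub>2 \<beta>\<^sub>1 \<beta>\<^sub>2.
        0 \<le> \<omega> \<and> pi / 2 < \<phi> \<and> \<phi> < pi \<and> 0 \<le> K\<^sub>1 \<and> 0 \<le> K\<^sub>2 \<and>
        0 < \<beta>\<^sub>1 \<and> \<beta>\<^sub>1 \<le> 1 \<and> 0 < \<beta>\<^sub>2 \<and> \<beta>\<^sub>2 \<le> 1 \<and> 1 < \<beta>\<^sub>1 + \<beta>\<^sub>2 \<and>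
        (\<forall>t. sector \<phi> \<union> {0} \<subseteq> resolvent_set (D t) (shift_op (A t) \<omega>)) \<and>
        (\<forall>t. \<forall>z\<in>sector \<phi>.
           onorm (resolvent (D t) (shift_op (A t) \<omega>) z) \<le> K\<^sub>1 / (1 + cmod z)) \<and>
        (\<forall>t s. \<forall>z\<in>sector \<phi>.
           onorm (\<lambda>x. shift_op (A t) \<omega> (resolvent (D t) (shift_op (A t) \<omega>) z
                        (resolvent (D t) (A t) (of_real \<omega>) x
                         - resolvent (D s) (A s) (of_real \<omega>) x)))
           \<le> K\<^sub>2 * \<bar>t - s\<bar> powr \<beta>\<^sub>1 * cmod z powr (- \<beta>\<^sub>2)))"

definition evolution_family :: "(real \<Rightarrow> real \<Rightarrow> 'a::complex_banach \<Rightarrow> 'a) \<Rightarrow> bool" where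
  "evolution_family U \<longleftrightarrow>
     (\<forall>t s. s \<le> t \<longrightarrow> bounded_clinear (U t s)) \<and>
     (\<forall>t x. U t t x = x) \<and>
     (\<forall>t s r x. r \<le> s \<and> s \<le> t \<longrightarrow> U t s (U s r x) = U t r x) \<and>
     (\<forall>x. continuous_on {(t, s). s \<le> t} (\<lambda>(t, s). U t s x))"

text \<open>\<open>U\<close> governs \<open>x'(t) = A(t) x(t)\<close>: for all \<open>s\<close> and \<open>x\<close>, \<open>t \<mapsto> U(t, s) x\<close> is a classical solution
  on \<open>(s, \<infinity>)\<close>, continuous up to \<open>s\<close> by the strong continuity of \<open>U\<close>.\<close>

definition governs_equation :: "(real \<Rightarrow> real \<Rightarrow> 'a::complex_banach \<Rightarrow> 'a) \<Rightarrow>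
    (real \<Rightarrow> 'a set) \<Rightarrow> (real \<Rightarrow> 'a \<Rightarrow> 'a) \<Rightarrow> bool" where
  "governs_equation U D A \<longleftrightarrow>
     (\<forall>s x.
        (\<forall>t>s. U t s x \<in> D t \<and>
               ((\<lambda>r. U r s x) has_vector_derivative A t (U t s x)) (at t)) \<and>
        continuous_on {s<..} (\<lambda>t. A t (U t s x)))"

section \<open>Almost automorphy\<close>

definition AA :: "(real \<Rightarrow> 'a::real_normed_vector) set" where
  "AA = {f. continuous_on UNIV f \<and> bounded (range f) \<and>
     (\<forall>\<sigma> :: nat \<Rightarrow> real. \<exists>r g. strict_mono r \<and>
        (\<forall>t. (\<lambda>n. f (t + \<sigma> (r n))) \<longlonglongrightarrow> g t \<and>
             (\<lambda>n. g (t - \<sigma> (r n))) \<longlonglongrightarrow> f t))}"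

text \<open>Here the subsequence and the limit function may depend on the bounded set \<open>B\<close>.\<close>

definition AA_param :: "(real \<Rightarrow> 'a \<Rightarrow> 'a::real_normed_vector) set" where
  "AA_param = {f. continuous_on UNIV (\<lambda>(t, x). f t x) \<and> bounded (range (\<lambda>(t, x). f t x)) \<and>
     (\<forall>B. bounded B \<longrightarrow>
       (\<forall>\<sigma> :: nat \<Rightarrow> real. \<exists>r g. strict_mono r \<and>
          (\<forall>t. uniform_limit B (\<lambda>n x. f (t + \<sigma> (r n)) x) (g t) sequentially \<and>
               uniform_limit B (\<lambda>n x. g (t - \<sigma> (r n)) x) (f t) sequentially)))}"

definition bi_AA_on_bounded :: "(real \<Rightarrow> real \<Rightarrow> 'a \<Rightarrow> 'a::real_normed_vector) \<Rightarrow> bool" where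
  "bi_AA_on_bounded U \<longleftrightarrow>
     (\<forall>x. continuous_on {(t, s). s \<le> t} (\<lambda>(t, s). U t s x)) \<and>
     (\<forall>B. bounded B \<longrightarrow>
       (\<forall>\<sigma> :: nat \<Rightarrow> real. \<exists>r V. strict_mono r \<and>
          (\<forall>t s. s \<le> t \<longrightarrow>
             uniform_limit B (\<lambda>n x. U (t + \<sigma> (r n)) (s + \<sigma> (r n)) x) (V t s) sequentially \<and>
             uniform_limit B (\<lambda>n x. V (t - \<sigma> (r n)) (s - \<sigma> (r n)) x) (U t s) sequentially)))"

section \<open>The delay equation\<close>

text \<open>Meaningful for bounded functions only.\<close>

definition sup_norm :: "(real \<Rightarrow> 'a::real_normed_vector) \<Rightarrow> real" where
  "sup_norm g = (SUP t. norm (g t))"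

text \<open>The integral is the gauge integral, which needs no separability of the space.\<close>

definition Gamma_op :: "(real \<Rightarrow> real \<Rightarrow> 'a \<Rightarrow> 'a) \<Rightarrow> (real \<Rightarrow> 'a \<Rightarrow> 'a::banach) \<Rightarrow> real \<Rightarrow>
    (real \<Rightarrow> 'a) \<Rightarrow> real \<Rightarrow> 'a" where
  "Gamma_op U f \<tau> x t = integral {..t} (\<lambda>s. U t s (f s (x (s - \<tau>))))"

definition center_fun :: "(real \<Rightarrow> real \<Rightarrow> 'a \<Rightarrow> 'a) \<Rightarrow> (real \<Rightarrow> 'a \<Rightarrow> 'a::banach) \<Rightarrow> real \<Rightarrow> 'a" where
  "center_fun U f t = integral {..t} (\<lambda>s. U t s (f s 0))"

definition mild_solution :: "(real \<Rightarrow> real \<Rightarrow> 'a \<Rightarrow> 'a) \<Rightarrow> (real \<Rightarrow> 'a \<Rightarrow> 'a::banach) \<Rightarrow> real \<Rightarrow>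
    (real \<Rightarrow> 'a) \<Rightarrow> bool" where
  "mild_solution U f \<tau> x \<longleftrightarrow>
     continuous_on UNIV x \<and>
     (\<forall>a t. a \<le> t \<longrightarrow>
        (\<lambda>s. U t s (f s (x (s - \<tau>)))) integrable_on {a..t} \<and>
        x t = U t a (x a) + integral {a..t} (\<lambda>s. U t s (f s (x (s - \<tau>)))))"

end

theory Submission
  imports Defs
begin

text \<open>
  The operator \<open>\<Gamma>\<close> is a contraction with constant \<open>c = M L / \<delta>\<close> on all bounded continuous functions, and
  \<open>0 < \<theta>\<close> forces \<open>c < 1\<close>. Its fixed points are exactly the bounded mild solutions, because
  \<open>U(t, a) x(a) \<rightarrow> 0\<close> as \<open>a \<rightarrow> -\<infinity>\<close>, and the fixed point satisfies
  \<open>\<parallel>x - x\<^sub>0\<parallel> \<le> c \<parallel>x - x\<^sub>0\<parallel> + \<parallel>\<Gamma> x\<^sub>0 - x\<^sub>0\<parallel>\<close>, that is, \<open>\<parallel>x - x\<^sub>0\<parallel> \<le> \<theta> \<le> \<rho>\<close>.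

  For almost automorphy, pass from a given sequence to a subsequence \<open>\<sigma>\<close> that works for \<open>f\<close> and \<open>U\<close> on
  sufficiently large balls. The functions that are almost automorphic along this one \<open>\<sigma>\<close> form a
  closed set that contains \<open>0\<close> and is mapped into itself by \<open>\<Gamma>\<close>, so it contains the fixed point; no
  further subsequence has to be chosen.
\<close>

section \<open>Improper gauge integrals with exponential domination\<close>

text \<open>The majorant has antiderivative \<open>C / \<delta> * exp (\<delta> * (s - t))\<close>.
  Its value at \<open>a\<close> is nonnegative and is dropped, so the estimate is uniform in
  \<open>a\<close>.\<close>

lemma norm_integral_exp_bound:
  fixes g :: "real \<Rightarrow> 'a::banach"
  assumes cont: "continuous_on {a..b} g" and "a \<le> b" and "0 < \<delta>"
    and bound: "\<And>s. s \<in> {a..b} \<Longrightarrow> norm (g s) \<le> C * exp (\<delta> * (s - t))"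
  shows "norm (integral {a..b} g) \<le> C / \<delta> * exp (\<delta> * (b - t))"
proof -
  \<comment> \<open>The sign of \<open>C\<close> is not assumed but read off from the bound at
    \<open>s = a\<close>.\<close>
  have "0 \<le> C * exp (\<delta> * (a - t))"
    using order_trans[OF norm_ge_zero bound[of a]] \<open>a \<le> b\<close> by simp
  then have "0 \<le> C"
    by (simp add: zero_le_mult_iff)
  have int: "((\<lambda>s. C * exp (\<delta> * (s - t))) has_integral
      (C / \<delta> * exp (\<delta> * (b - t)) - C / \<delta> * exp (\<delta> * (a - t)))) {a..b}"
    using \<open>0 < \<delta>\<close> \<open>a \<le> b\<close>
    by (intro fundamental_theorem_of_calculus)
      (auto intro!: derivative_eq_intros simp: has_real_derivative_iff_has_vector_derivative[symmetric])
  have "norm (integral {a..b} g) \<le> integral {a..b} (\<lambda>s. C * exp (\<delta> * (s - t)))"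
    using int bound
    by (intro integral_norm_bound_integral integrable_continuous_interval[OF cont]) auto
  also have "\<dots> \<le> C / \<delta> * exp (\<delta> * (b - t))"
    unfolding integral_unique[OF int] using \<open>0 \<le> C\<close> \<open>0 < \<delta>\<close> by simp
  finally show ?thesis .
qed

text \<open>The shape of every integrand in \<Gamma>: the point \<open>t\<close> is both the upper
  endpoint and the place where the exponential weight equals 1.\<close>

locale exp_dominated =
  fixes g :: "real \<Rightarrow> 'a::banach" and C \<delta> t :: real
  assumes cont: "continuous_on {..t} g" and rate_pos: "0 < \<delta>"
    and bound: "\<And>s. s \<le> t \<Longrightarrow> norm (g s) \<le> C * exp (\<delta> * (s - t))"
begin

lemma norm_integral_Icc:
  assumes "a \<le> b" "b \<le> t"
  shows "norm (integral {a..b} g) \<le> C / \<delta> * exp (\<delta> * (b - t))"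
  using assms by (intro norm_integral_exp_bound continuous_on_subset[OF cont] rate_pos bound) auto

lemma integral_diff_Icc:
  assumes "a \<le> b" "b \<le> t"
  shows "norm (integral {a..t} g - integral {b..t} g) \<le> C / \<delta> * exp (\<delta> * (b - t))"
proof -
  have "integral {a..b} g + integral {b..t} g = integral {a..t} g"
    using assms by (intro Henstock_Kurzweil_Integration.integral_combine
        integrable_continuous_interval continuous_on_subset[OF cont]) auto
  then show ?thesis
    using norm_integral_Icc[OF assms] by (metis add_diff_cancel_right')
qed

lemma tail_tendsto_0: "(\<lambda>n. C / \<delta> * exp (- \<delta> * real n)) \<longlonglongrightarrow> 0"
proof -
  have "(\<lambda>n. exp (- \<delta>) ^ n) \<longlonglongrightarrow> 0"
    using rate_pos by (intro LIMSEQ_realpow_zero) auto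
  then have "(\<lambda>n. exp (- \<delta> * real n)) \<longlonglongrightarrow> 0"
    by (simp add: exp_of_nat_mult[symmetric] mult.commute)
  then show ?thesis
    by (rule tendsto_mult_right_zero)
qed

text \<open>The integrals over \<open>{t - n..t}\<close> are Cauchy because the discarded tails
  decay exponentially. The same tail estimate, valid for every lower endpoint, gives the convergence
  over arbitrary large boxes that the gauge integral on an unbounded set demands.\<close>

lemma ex_has_integral_atMost:
  "\<exists>l. (\<lambda>n. integral {t - real n..t} g) \<longlonglongrightarrow> l \<and> (g has_integral l) {..t}"
proof -
  let ?I = "\<lambda>n::nat. integral {t - real n..t} g"
  have diff: "norm (integral {a..t} g - ?I n) \<le> C / \<delta> * exp (- \<delta> * real n)" if "a \<le> t - real n" for a n
    using integral_diff_Icc[OF that] by simp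
  have "Cauchy ?I"
  proof (rule CauchyI')
    fix e :: real assume "0 < e"
    from LIMSEQ_D[OF tail_tendsto_0 this]
    obtain N where N: "\<And>n. n \<ge> N \<Longrightarrow> norm (C / \<delta> * exp (- \<delta> * real n) - 0) < e" by blast
    have "dist (?I m) (?I n) < e" if "m \<ge> N" "n > m" for m n
    proof -
      have "norm (?I n - ?I m) \<le> C / \<delta> * exp (- \<delta> * real m)"
        using that by (intro diff) auto
      also have "\<dots> < e"
        using N[OF that(1)] by (simp add: abs_if split: if_splits)
      finally show ?thesis by (simp add: dist_norm norm_minus_commute)
    qed
    then show "\<exists>N. \<forall>m\<ge>N. \<forall>n>m. dist (?I m) (?I n) < e" by blast
  qed
  then obtain l where l: "?I \<longlonglongrightarrow> l"
    using Cauchy_convergent convergent_def by blast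
  \<comment> \<open>Extension by zero cuts a box at \<open>t\<close>; if \<open>min b t < a\<close>,
    both sides are zero.\<close>
  have ext: "((\<lambda>x. if x \<in> {..t} then g x else 0) has_integral integral {a..min b t} g) (cbox a b)" for a b
  proof -
    have "(g has_integral integral {a..min b t} g) ({..t} \<inter> {a..b})"
      using integrable_integral[OF integrable_continuous_interval[OF continuous_on_subset[OF cont]],
          of a "min b t"]
      by (simp add: Int_commute min.commute)
    then show ?thesis
      using has_integral_restrict_Int[of "{..t}" g] by simp
  qed
  have "(g has_integral l) {..t}"
    unfolding has_integral_alt'
  proof (intro conjI allI impI)
    show "(\<lambda>x. if x \<in> {..t} then g x else 0) integrable_on cbox a b" for a b
      using ext[of a b] by blast
  next
    fix e :: real assume "0 < e"
    then have "0 < e / 2" by simp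
    from LIMSEQ_D[OF tail_tendsto_0 this] obtain N1
      where N1: "\<And>n. n \<ge> N1 \<Longrightarrow> norm (C / \<delta> * exp (- \<delta> * real n) - 0) < e / 2" by blast
    from LIMSEQ_D[OF l \<open>0 < e / 2\<close>] obtain N2 where N2: "\<And>n. n \<ge> N2 \<Longrightarrow> norm (?I n - l) < e / 2" by blast
    define N where "N = max N1 N2"
    \<comment> \<open>The radius forces the box to contain both \<open>t\<close> and
      \<open>t - N\<close>, so only the part of the integral to the left of \<open>t - N\<close> can
      differ from the truncated one.\<close>
    have "norm (integral (cbox a b) (\<lambda>x. if x \<in> {..t} then g x else 0) - l) < e"
      if "ball 0 (\<bar>t\<bar> + real N + 1) \<subseteq> cbox a b" for a b
    proof -
      have "t \<in> ball 0 (\<bar>t\<bar> + real N + 1)" "t - real N \<in> ball 0 (\<bar>t\<bar> + real N + 1)"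
        by auto
      with that have "t \<in> cbox a b" "t - real N \<in> cbox a b" by blast+
      then have ab: "a \<le> t - real N" "t \<le> b" by auto
      then have eq: "integral (cbox a b) (\<lambda>x. if x \<in> {..t} then g x else 0) = integral {a..t} g"
        using integral_unique[OF ext[of a b]] by (simp add: min_absorb2)
      have "norm (integral {a..t} g - ?I N) < e / 2"
        by (rule le_less_trans[OF diff[OF ab(1)]],
            rule le_less_trans[OF abs_ge_self N1[of N, unfolded real_norm_def diff_zero]])
          (simp add: N_def)
      moreover have "norm (?I N - l) < e / 2"
        by (rule N2) (simp add: N_def)
      ultimately show ?thesis
        unfolding eq using norm_triangle_ineq[of "integral {a..t} g - ?I N" "?I N - l"] by simp
    qed
    then show "\<exists>B>0. \<forall>a b. ball 0 B \<subseteq> cbox a b \<longrightarrow>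
        norm (integral (cbox a b) (\<lambda>x. if x \<in> {..t} then g x else 0) - l) < e"
      by (intro exI[of _ "\<bar>t\<bar> + real N + 1"]) auto
  qed
  with l show ?thesis by blast
qed

lemma integrable_atMost: "g integrable_on {..t}"
  using ex_has_integral_atMost by blast

lemma integral_atMost_LIMSEQ: "(\<lambda>n. integral {t - real n..t} g) \<longlonglongrightarrow> integral {..t} g"
  using ex_has_integral_atMost by (metis integral_unique)

lemma norm_integral_atMost: "norm (integral {..t} g) \<le> C / \<delta>"
proof (rule LIMSEQ_le_const2[OF tendsto_norm[OF integral_atMost_LIMSEQ]])
  show "\<exists>N. \<forall>n\<ge>N. norm (integral {t - real n..t} g) \<le> C / \<delta>"
    using norm_integral_Icc[of "t - real n" t for n] by auto
qed

lemma shift_exp_dominated: "exp_dominated (\<lambda>u. g (t + u)) C \<delta> 0"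
proof
  show "continuous_on {..0} (\<lambda>u. g (t + u))"
    by (rule continuous_on_compose2[OF cont]) (auto intro!: continuous_intros)
  show "norm (g (t + u)) \<le> C * exp (\<delta> * (u - 0))" if "u \<le> 0" for u
    using bound[of "t + u"] that by simp
qed (rule rate_pos)

text \<open>Moves the dependence on \<open>t\<close> from the domain into the integrand, so that
  limits in \<open>t\<close> can be taken over the fixed half-line \<open>{..0}\<close>. The
  translation is done on bounded intervals and passed to the limit.\<close>

lemma integral_atMost_shift: "integral {..t} g = integral {..0} (\<lambda>u. g (t + u))"
proof -
  interpret s: exp_dominated "\<lambda>u. g (t + u)" C \<delta> 0
    by (rule shift_exp_dominated)
  have "integral {0 - real n..0} (\<lambda>u. g (t + u)) = integral {t - real n..t} g" for n
    using has_integral_shift_Icc_real[of g t "integral {t - real n..t} g" "0 - real n" 0]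
      integrable_integral[OF integrable_continuous_interval[OF continuous_on_subset[OF cont]],
        of "t - real n" t]
    by (intro integral_unique) (simp add: o_def)
  then show ?thesis
    using integral_atMost_LIMSEQ s.integral_atMost_LIMSEQ by (simp add: LIMSEQ_unique)
qed

text \<open>On \<open>{..a}\<close> the same function is dominated with the weight renormalised at
  \<open>a\<close>, at the cost of the factor \<open>exp (\<delta> * (a - t))\<close>. The two
  pieces meet only in \<open>a\<close>.\<close>

lemma integral_atMost_split:
  assumes "a \<le> t"
  shows "integral {..t} g = integral {..a} g + integral {a..t} g"
    and "g integrable_on {..a}" and "g integrable_on {a..t}"
proof -
  have "exp_dominated g (C * exp (\<delta> * (a - t))) \<delta> a"
  proof
    show "continuous_on {..a} g"
      using assms by (intro continuous_on_subset[OF cont]) auto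
    show "norm (g s) \<le> C * exp (\<delta> * (a - t)) * exp (\<delta> * (s - a))" if "s \<le> a" for s
      using bound[of s] that assms by (simp add: mult.assoc exp_add[symmetric] algebra_simps)
  qed (rule rate_pos)
  then show 1: "g integrable_on {..a}"
    by (rule exp_dominated.integrable_atMost)
  show 2: "g integrable_on {a..t}"
    by (intro integrable_continuous_interval continuous_on_subset[OF cont]) auto
  have "(g has_integral integral {..a} g + integral {a..t} g) ({..a} \<union> {a..t})"
  proof (rule has_integral_Un)
    have "{..a} \<inter> {a..t} \<subseteq> {a}" by auto
    then show "negligible ({..a} \<inter> {a..t})"
      using negligible_subset negligible_sing by blast
  qed (intro integrable_integral 1 2)+
  moreover have "{..a} \<union> {a..t} = {..t}" using assms by auto
  ultimately show "integral {..t} g = integral {..a} g + integral {a..t} g"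
    by (simp add: integral_unique)
qed

end

section \<open>Comparison and limits of dominated integrals\<close>

lemma exp_integrable_atMost_0:
  fixes \<delta> :: real
  assumes "0 < \<delta>"
  shows "(\<lambda>u. C * exp (\<delta> * u)) integrable_on {..0}"
proof -
  \<comment> \<open>The absolute value allows for negative \<open>C\<close>.\<close>
  have "exp_dominated (\<lambda>u. C * exp (\<delta> * u)) \<bar>C\<bar> \<delta> 0"
    by unfold_locales (auto intro!: continuous_intros assms simp: abs_mult)
  then show ?thesis by (rule exp_dominated.integrable_atMost)
qed

lemma exp_dominated_diff:
  assumes "exp_dominated g C \<delta> t" "exp_dominated h C' \<delta> t"
  shows "exp_dominated (\<lambda>s. g s - h s) (C + C') \<delta> t"
proof -
  interpret g: exp_dominated g C \<delta> t by fact
  interpret h: exp_dominated h C' \<delta> t by fact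
  show ?thesis
  proof
    show "norm (g s - h s) \<le> (C + C') * exp (\<delta> * (s - t))" if "s \<le> t" for s
      using norm_triangle_ineq4[of "g s" "h s"] g.bound[OF that] h.bound[OF that]
      by (simp add: distrib_right)
  qed (intro continuous_intros g.cont h.cont g.rate_pos)+
qed

lemma exp_dominated_norm:
  assumes "exp_dominated g C \<delta> t"
  shows "exp_dominated (\<lambda>s. norm (g s)) C \<delta> t"
proof -
  interpret exp_dominated g C \<delta> t by fact
  show ?thesis
    by unfold_locales (auto intro!: continuous_intros cont rate_pos bound)
qed

lemma norm_integral_diff_le:
  assumes "exp_dominated g C \<delta> t" "exp_dominated h C' \<delta> t"
  shows "norm (integral {..t} g - integral {..t} h) \<le> integral {..t} (\<lambda>s. norm (g s - h s))"
    and "(\<lambda>s. norm (g s - h s)) integrable_on {..t}"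
proof -
  note d = exp_dominated_diff[OF assms]
  show n: "(\<lambda>s. norm (g s - h s)) integrable_on {..t}"
    by (rule exp_dominated.integrable_atMost[OF exp_dominated_norm[OF d]])
  have "integral {..t} g - integral {..t} h = integral {..t} (\<lambda>s. g s - h s)"
    using assms by (intro Henstock_Kurzweil_Integration.integral_diff[symmetric])
      (auto intro: exp_dominated.integrable_atMost)
  then show "norm (integral {..t} g - integral {..t} h) \<le> integral {..t} (\<lambda>s. norm (g s - h s))"
    using integral_norm_bound_integral[OF exp_dominated.integrable_atMost[OF d] n] by simp
qed

text \<open>The pointwise limit \<open>\<Psi>\<close> need not be measurable in any sense suited to a non-separable space,
  so it is never integrated; dominated convergence is applied only to real-valued norms of differences.\<close>

lemma exp_dominated_limit_dist:
  fixes \<Phi> :: "nat \<Rightarrow> real \<Rightarrow> 'a::banach"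
  assumes dom: "\<And>n. exp_dominated (\<Phi> n) C \<delta> 0" and G: "exp_dominated G C' \<delta> 0"
    and lim: "\<And>u. u \<le> 0 \<Longrightarrow> (\<lambda>n. \<Phi> n u) \<longlonglongrightarrow> \<Psi> u"
  shows "(\<lambda>u. norm (\<Psi> u - G u)) integrable_on {..0}"
    and "(\<lambda>n. integral {..0} (\<lambda>u. norm (\<Phi> n u - G u))) \<longlonglongrightarrow> integral {..0} (\<lambda>u. norm (\<Psi> u - G u))"
proof -
  note d = exp_dominated_norm[OF exp_dominated_diff[OF dom G]]
  have rate: "0 < \<delta>" by (rule exp_dominated.rate_pos[OF G])
  note dct = dominated_convergence[where f = "\<lambda>n u. norm (\<Phi> n u - G u)" and g = "\<lambda>u. norm (\<Psi> u - G u)",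
      OF exp_dominated.integrable_atMost[OF d] exp_integrable_atMost_0[OF rate, of "C + C'"]]
  have 1: "norm (norm (\<Phi> n u - G u)) \<le> (C + C') * exp (\<delta> * u)" if "u \<in> {..0}" for n u
    using exp_dominated.bound[OF d, of u n] that by simp
  have 2: "(\<lambda>n. norm (\<Phi> n u - G u)) \<longlonglongrightarrow> norm (\<Psi> u - G u)" if "u \<in> {..0}" for u
    using lim that by (intro tendsto_intros) auto
  show "(\<lambda>u. norm (\<Psi> u - G u)) integrable_on {..0}"
    and "(\<lambda>n. integral {..0} (\<lambda>u. norm (\<Phi> n u - G u))) \<longlonglongrightarrow> integral {..0} (\<lambda>u. norm (\<Psi> u - G u))"
    using dct 1 2 by blast+
qed

text \<open>Convergence in mean to \<Psi>. Integrability of the distance comes from the preceding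
  lemma with \<open>\<Phi> n\<close> itself as comparison function; \<Psi> inherits the pointwise
  bound, so twice the majorant dominates.\<close>

lemma exp_dominated_limit_norm_tendsto_0:
  fixes \<Phi> :: "nat \<Rightarrow> real \<Rightarrow> 'a::banach"
  assumes dom: "\<And>n. exp_dominated (\<Phi> n) C \<delta> 0"
    and lim: "\<And>u. u \<le> 0 \<Longrightarrow> (\<lambda>n. \<Phi> n u) \<longlonglongrightarrow> \<Psi> u"
  shows "(\<lambda>u. norm (\<Psi> u - \<Phi> n u)) integrable_on {..0}"
    and "(\<lambda>n. integral {..0} (\<lambda>u. norm (\<Psi> u - \<Phi> n u))) \<longlonglongrightarrow> 0"
proof -
  have rate: "0 < \<delta>" by (rule exp_dominated.rate_pos[OF dom])
  show int: "(\<lambda>u. norm (\<Psi> u - \<Phi> n u)) integrable_on {..0}" for n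
    by (rule exp_dominated_limit_dist(1)[OF dom dom lim])
  have bound: "norm (norm (\<Psi> u - \<Phi> n u)) \<le> (C + C) * exp (\<delta> * u)" if "u \<in> {..0}" for n u
  proof -
    have "norm (\<Psi> u) \<le> C * exp (\<delta> * u)"
      using exp_dominated.bound[OF dom, of u] that
      by (intro LIMSEQ_le_const2[OF tendsto_norm[OF lim[of u]]]) auto
    then show ?thesis
      using norm_triangle_ineq4[of "\<Psi> u" "\<Phi> n u"] exp_dominated.bound[OF dom, of u n] that
      by (simp add: distrib_right)
  qed
  have "(\<lambda>n. norm (\<Psi> u - \<Phi> n u)) \<longlonglongrightarrow> 0" if "u \<in> {..0}" for u
    using tendsto_norm[OF tendsto_diff[OF tendsto_const lim[of u], of "\<Psi> u"]] that by simp
  from dominated_convergence(2)[OF int exp_integrable_atMost_0[OF rate] bound this]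
  show "(\<lambda>n. integral {..0} (\<lambda>u. norm (\<Psi> u - \<Phi> n u))) \<longlonglongrightarrow> 0" by simp
qed

text \<open>The Cauchy property follows from the triangle inequality through \<Psi>. The limit
  \<open>l\<close> stands in for an integral of \<Psi>, and the second property is the norm
  inequality that such an integral would satisfy against dominated functions.\<close>

lemma exp_dominated_integral_convergent:
  fixes \<Phi> :: "nat \<Rightarrow> real \<Rightarrow> 'a::banach"
  assumes dom: "\<And>n. exp_dominated (\<Phi> n) C \<delta> 0"
    and lim: "\<And>u. u \<le> 0 \<Longrightarrow> (\<lambda>n. \<Phi> n u) \<longlonglongrightarrow> \<Psi> u"
  obtains l where "(\<lambda>n. integral {..0} (\<Phi> n)) \<longlonglongrightarrow> l"
    and "\<And>G C'. exp_dominated G C' \<delta> 0 \<Longrightarrow>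
      norm (l - integral {..0} G) \<le> integral {..0} (\<lambda>u. norm (\<Psi> u - G u))"
proof -
  define E where "E n = integral {..0} (\<lambda>u. norm (\<Psi> u - \<Phi> n u))" for n
  note E = exp_dominated_limit_norm_tendsto_0[OF dom lim, folded E_def]
  have diff: "norm (integral {..0} (\<Phi> m) - integral {..0} (\<Phi> n)) \<le> E m + E n" for m n
  proof -
    have "norm (integral {..0} (\<Phi> m) - integral {..0} (\<Phi> n)) \<le> integral {..0} (\<lambda>u. norm (\<Phi> m u - \<Phi> n u))"
      by (rule norm_integral_diff_le(1)[OF dom dom])
    also have "\<dots> \<le> integral {..0} (\<lambda>u. norm (\<Psi> u - \<Phi> m u) + norm (\<Psi> u - \<Phi> n u))"
    proof (rule integral_le)
      show "norm (\<Phi> m u - \<Phi> n u) \<le> norm (\<Psi> u - \<Phi> m u) + norm (\<Psi> u - \<Phi> n u)" for u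
        using norm_triangle_ineq4[of "\<Psi> u - \<Phi> n u" "\<Psi> u - \<Phi> m u"] by simp
    qed (intro norm_integral_diff_le(2)[OF dom dom] integrable_add E(1))+
    also have "\<dots> = E m + E n"
      unfolding E_def by (intro Henstock_Kurzweil_Integration.integral_add E(1))
    finally show ?thesis .
  qed
  have "Cauchy (\<lambda>n. integral {..0} (\<Phi> n))"
  proof (rule CauchyI)
    fix e :: real assume "0 < e"
    then have "0 < e / 2" by simp
    from LIMSEQ_D[OF E(2) this] obtain N where N: "\<And>n. n \<ge> N \<Longrightarrow> norm (E n - 0) < e / 2" by blast
    have "norm (integral {..0} (\<Phi> m) - integral {..0} (\<Phi> n)) < e" if "m \<ge> N" "n \<ge> N" for m n
      using diff[of m n] N[OF that(1)] N[OF that(2)] by (simp add: abs_if split: if_splits)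
    then show "\<exists>N. \<forall>m\<ge>N. \<forall>n\<ge>N. norm (integral {..0} (\<Phi> m) - integral {..0} (\<Phi> n)) < e" by blast
  qed
  then obtain l where l: "(\<lambda>n. integral {..0} (\<Phi> n)) \<longlonglongrightarrow> l"
    using Cauchy_convergent convergent_def by blast
  moreover have "norm (l - integral {..0} G) \<le> integral {..0} (\<lambda>u. norm (\<Psi> u - G u))"
    if G: "exp_dominated G C' \<delta> 0" for G C'
    using norm_integral_diff_le(1)[OF dom G]
    by (intro LIMSEQ_le[OF tendsto_norm[OF tendsto_diff[OF l tendsto_const]]
          exp_dominated_limit_dist(2)[OF dom G lim]]) auto
  ultimately show thesis by (rule that)
qed

lemma exp_dominated_integral_tendsto:
  fixes \<Phi> :: "nat \<Rightarrow> real \<Rightarrow> 'a::banach"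
  assumes dom: "\<And>n. exp_dominated (\<Phi> n) C \<delta> 0" and G: "exp_dominated G C' \<delta> 0"
    and lim: "\<And>u. u \<le> 0 \<Longrightarrow> (\<lambda>n. \<Phi> n u) \<longlonglongrightarrow> G u"
  shows "(\<lambda>n. integral {..0} (\<Phi> n)) \<longlonglongrightarrow> integral {..0} G"
proof -
  \<comment> \<open>Taking \<Psi> to be \<open>G\<close> makes the comparison bound zero, which
    identifies \<open>l\<close>.\<close>
  obtain l where l: "(\<lambda>n. integral {..0} (\<Phi> n)) \<longlonglongrightarrow> l"
    "norm (l - integral {..0} G) \<le> integral {..0} (\<lambda>u. norm (G u - G u))"
    using exp_dominated_integral_convergent[OF dom lim] G by metis
  then show ?thesis by simp
qed

section \<open>Almost automorphy along a fixed sequence\<close>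

text \<open>The limit function is an explicit argument because limits of compositions are built from
  the limits of their parts. Only pointwise convergence is asked of it.\<close>

definition aa_along :: "(nat \<Rightarrow> real) \<Rightarrow> (real \<Rightarrow> 'a::metric_space) \<Rightarrow> (real \<Rightarrow> 'a) \<Rightarrow> bool" where
  "aa_along \<sigma> x y \<longleftrightarrow> (\<forall>t. (\<lambda>n. x (t + \<sigma> n)) \<longlonglongrightarrow> y t \<and> (\<lambda>n. y (t - \<sigma> n)) \<longlonglongrightarrow> x t)"

lemma aa_alongD:
  assumes "aa_along \<sigma> x y"
  shows "(\<lambda>n. x (t + \<sigma> n)) \<longlonglongrightarrow> y t" and "(\<lambda>n. y (t - \<sigma> n)) \<longlonglongrightarrow> x t"
  using assms by (auto simp: aa_along_def)

lemma aa_along_limit_in_closed: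
  assumes "aa_along \<sigma> x y" "closed B" "\<And>t. x t \<in> B"
  shows "y t \<in> B"
  by (rule closed_sequentially[OF assms(2) assms(3) aa_alongD(1)[OF assms(1)]])

text \<open>No convergence of the \<open>y k\<close> is presupposed: \<open>w\<close> comes from
  completeness, since an e/3 argument makes each translated sequence of \<open>z\<close> Cauchy. A
  second e/3 argument gives the return limit.\<close>

lemma aa_along_uniform_limit:
  fixes x :: "nat \<Rightarrow> real \<Rightarrow> 'a::banach"
  assumes aa: "\<And>k. aa_along \<sigma> (x k) (y k)" and unif: "uniform_limit UNIV x z sequentially"
  shows "\<exists>w. aa_along \<sigma> z w"
proof -
  have approx: "\<exists>k. \<forall>t. dist (x k t) (z t) < e" if "0 < e" for e
    using uniform_limitD[OF unif that] eventually_happens'[OF sequentially_bot] by (force simp: eventually_sequentially)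
  have "Cauchy (\<lambda>n. z (t + \<sigma> n))" for t
  proof (rule metric_CauchyI)
    fix e :: real assume "0 < e"
    then have "0 < e / 3" by simp
    from approx[OF this] obtain k where k: "\<And>t. dist (x k t) (z t) < e / 3" by blast
    have "Cauchy (\<lambda>n. x k (t + \<sigma> n))"
      using aa_alongD(1)[OF aa] by (rule LIMSEQ_imp_Cauchy)
    from metric_CauchyD[OF this \<open>0 < e / 3\<close>] obtain N
      where N: "\<And>m n. m \<ge> N \<Longrightarrow> n \<ge> N \<Longrightarrow> dist (x k (t + \<sigma> m)) (x k (t + \<sigma> n)) < e / 3" by blast
    have "dist (z (t + \<sigma> m)) (z (t + \<sigma> n)) < e" if "m \<ge> N" "n \<ge> N" for m n
      using N[OF that] k[of "t + \<sigma> m"] k[of "t + \<sigma> n"]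
        dist_triangle3[of "z (t + \<sigma> m)" "z (t + \<sigma> n)" "x k (t + \<sigma> m)"]
        dist_triangle[of "x k (t + \<sigma> m)" "z (t + \<sigma> n)" "x k (t + \<sigma> n)"]
      by simp
    then show "\<exists>N. \<forall>m\<ge>N. \<forall>n\<ge>N. dist (z (t + \<sigma> m)) (z (t + \<sigma> n)) < e" by blast
  qed
  then have "\<forall>t. \<exists>l. (\<lambda>n. z (t + \<sigma> n)) \<longlonglongrightarrow> l"
    using Cauchy_convergent convergent_def by blast
  then obtain w where w: "\<And>t. (\<lambda>n. z (t + \<sigma> n)) \<longlonglongrightarrow> w t" by metis
  have "(\<lambda>n. w (t - \<sigma> n)) \<longlonglongrightarrow> z t" for t
  proof (rule metric_LIMSEQ_I)
    fix e :: real assume "0 < e"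
    then have "0 < e / 3" by simp
    from approx[OF this] obtain k where k: "\<And>t. dist (x k t) (z t) < e / 3" by blast
    \<comment> \<open>The estimate between \<open>x k\<close> and \<open>z\<close> is uniform in
      time, hence survives the pointwise limit along \<sigma>.\<close>
    have yw: "dist (y k s) (w s) \<le> e / 3" for s
      using k by (intro LIMSEQ_le_const2[OF tendsto_dist[OF aa_alongD(1)[OF aa] w]]) (auto intro: less_imp_le)
    from metric_LIMSEQ_D[OF aa_alongD(2)[OF aa] \<open>0 < e / 3\<close>] obtain N
      where N: "\<And>n. n \<ge> N \<Longrightarrow> dist (y k (t - \<sigma> n)) (x k t) < e / 3" by blast
    have "dist (w (t - \<sigma> n)) (z t) < e" if "n \<ge> N" for n
      using N[OF that] k[of t] yw[of "t - \<sigma> n"]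
        dist_triangle3[of "w (t - \<sigma> n)" "z t" "y k (t - \<sigma> n)"]
        dist_triangle[of "y k (t - \<sigma> n)" "z t" "x k t"]
      by simp
    then show "\<exists>N. \<forall>n\<ge>N. dist (w (t - \<sigma> n)) (z t) < e" by blast
  qed
  with w have "aa_along \<sigma> z w" by (auto simp: aa_along_def)
  then show ?thesis by blast
qed

lemma AA_altdef:
  "x \<in> AA \<longleftrightarrow> continuous_on UNIV x \<and> bounded (range x) \<and>
     (\<forall>\<sigma>. \<exists>r y. strict_mono (r :: nat \<Rightarrow> nat) \<and> aa_along (\<sigma> \<circ> r) x y)"
  by (simp add: AA_def aa_along_def)

lemma lipschitz_on_limit:
  fixes T :: "nat \<Rightarrow> 'a::metric_space \<Rightarrow> 'b::metric_space"
  assumes lip: "\<And>n. C-lipschitz_on B (T n)" and lim: "\<And>y. y \<in> B \<Longrightarrow> (\<lambda>n. T n y) \<longlonglongrightarrow> S y"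
  shows "C-lipschitz_on B S"
proof (rule lipschitz_onI)
  show "dist (S y) (S z) \<le> C * dist y z" if "y \<in> B" "z \<in> B" for y z
    using lipschitz_onD[OF lip that]
    by (intro LIMSEQ_le_const2[OF tendsto_dist[OF lim[OF that(1)] lim[OF that(2)]]]) auto
qed (rule lipschitz_on_nonneg[OF lip])

text \<open>The common Lipschitz constant lets the moving argument \<open>x n\<close> be replaced by
  \<open>y\<close> with error at most \<open>C * dist (x n) y\<close>.\<close>

lemma lipschitz_on_tendsto_comp:
  fixes T :: "nat \<Rightarrow> 'a::metric_space \<Rightarrow> 'b::metric_space"
  assumes lip: "\<And>n. C-lipschitz_on B (T n)" and lim: "(\<lambda>n. T n y) \<longlonglongrightarrow> l"
    and x: "x \<longlonglongrightarrow> y" "\<And>n. x n \<in> B" "y \<in> B"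
  shows "(\<lambda>n. T n (x n)) \<longlonglongrightarrow> l"
proof -
  have "(\<lambda>n. C * dist (x n) y + dist (T n y) l) \<longlonglongrightarrow> C * dist y y + dist l l"
    by (intro tendsto_intros x lim)
  then have "(\<lambda>n. C * dist (x n) y + dist (T n y) l) \<longlonglongrightarrow> 0" by simp
  moreover have "dist (T n (x n)) l \<le> C * dist (x n) y + dist (T n y) l" for n
    using lipschitz_onD[OF lip x(2) x(3), of n n] dist_triangle[of "T n (x n)" l "T n y"] by simp
  ultimately show ?thesis
    by (subst tendsto_dist_iff) (auto intro: Lim_null_comparison[rotated])
qed

text \<open>Here \<open>T t\<close> stands both for the nonlinearity \<open>f(t, \<cdot>)\<close> and, for fixed \<open>u \<le> 0\<close>, for \<open>U(t, t + u)\<close>.\<close>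

lemma aa_along_comp:
  fixes T :: "real \<Rightarrow> 'a::metric_space \<Rightarrow> 'b::metric_space"
  assumes x: "aa_along \<sigma> x y" "\<And>t. x t \<in> B" "closed B"
    and lip: "\<And>t. C-lipschitz_on B (T t)"
    and T: "\<And>z. z \<in> B \<Longrightarrow> aa_along \<sigma> (\<lambda>t. T t z) (\<lambda>t. S t z)"
  shows "aa_along \<sigma> (\<lambda>t. T t (x (t + c))) (\<lambda>t. S t (y (t + c)))"
  unfolding aa_along_def
proof (intro allI conjI)
  fix t
  \<comment> \<open>Closedness of \<open>B\<close> keeps the limit values where the hypothesis on
    \<open>T\<close> and the Lipschitz bounds apply.\<close>
  have y: "y s \<in> B" for s
    by (rule aa_along_limit_in_closed[OF x(1) x(3) x(2)])
  show "(\<lambda>n. T (t + \<sigma> n) (x (t + \<sigma> n + c))) \<longlonglongrightarrow> S t (y (t + c))"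
    using aa_alongD(1)[OF x(1), of "t + c"] aa_alongD(1)[OF T[OF y[of "t + c"]], of t]
    by (intro lipschitz_on_tendsto_comp[OF lip _ _ x(2) y]) (auto simp: ac_simps)
  \<comment> \<open>On the way back the limit maps \<open>S\<close> themselves vary with
    \<open>n\<close>, so they need the same Lipschitz constant.\<close>
  have lipS: "C-lipschitz_on B (S s)" for s
    by (rule lipschitz_on_limit[OF lip]) (rule aa_alongD(1)[OF T])
  show "(\<lambda>n. S (t - \<sigma> n) (y (t - \<sigma> n + c))) \<longlonglongrightarrow> T t (x (t + c))"
    using aa_alongD(2)[OF x(1), of "t + c"] aa_alongD(2)[OF T[OF x(2)[of "t + c"]], of t]
    by (intro lipschitz_on_tendsto_comp[OF lipS _ _ y x(2)]) (auto simp: algebra_simps)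
qed

text \<open>The forward limit \<open>w\<close> is supplied by
  \<open>exp_dominated_integral_convergent\<close>. Its comparison inequality bounds the return
  error by a real integral of \<open>norm (\<Psi> (t - \<sigma> n) u - \<Phi> t u)\<close>, which
  vanishes by dominated convergence.\<close>

lemma aa_along_integral:
  fixes \<Phi> :: "real \<Rightarrow> real \<Rightarrow> 'a::banach"
  assumes dom: "\<And>t. exp_dominated (\<Phi> t) C \<delta> 0"
    and aa: "\<And>u. u \<le> 0 \<Longrightarrow> aa_along \<sigma> (\<lambda>t. \<Phi> t u) (\<lambda>t. \<Psi> t u)"
  shows "\<exists>w. aa_along \<sigma> (\<lambda>t. integral {..0} (\<Phi> t)) w"
proof -
  have rate: "0 < \<delta>" by (rule exp_dominated.rate_pos[OF dom])
  have "\<exists>l. (\<lambda>n. integral {..0} (\<Phi> (t + \<sigma> n))) \<longlonglongrightarrow> l \<and>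
      (\<forall>s. norm (l - integral {..0} (\<Phi> s)) \<le> integral {..0} (\<lambda>u. norm (\<Psi> t u - \<Phi> s u)))" for t
    using exp_dominated_integral_convergent[of "\<lambda>n. \<Phi> (t + \<sigma> n)", OF dom aa_alongD(1)[OF aa]] dom
    by metis
  then obtain w where w: "\<And>t. (\<lambda>n. integral {..0} (\<Phi> (t + \<sigma> n))) \<longlonglongrightarrow> w t"
    and dist: "\<And>t s. norm (w t - integral {..0} (\<Phi> s)) \<le> integral {..0} (\<lambda>u. norm (\<Psi> t u - \<Phi> s u))"
    by metis
  have \<Psi>: "norm (\<Psi> t u) \<le> C * exp (\<delta> * u)" if "u \<le> 0" for t u
    using exp_dominated.bound[OF dom that]
    by (intro LIMSEQ_le_const2[OF tendsto_norm[OF aa_alongD(1)[OF aa[OF that]]]]) auto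
  have "(\<lambda>n. w (t - \<sigma> n)) \<longlonglongrightarrow> integral {..0} (\<Phi> t)" for t
  proof -
    have int: "(\<lambda>u. norm (\<Psi> (t - \<sigma> n) u - \<Phi> t u)) integrable_on {..0}" for n
      by (rule exp_dominated_limit_dist(1)[OF dom dom]) (rule aa_alongD(1)[OF aa])
    have bound: "norm (norm (\<Psi> (t - \<sigma> n) u - \<Phi> t u)) \<le> (C + C) * exp (\<delta> * u)" if "u \<in> {..0}" for n u
      using norm_triangle_ineq4[of "\<Psi> (t - \<sigma> n) u" "\<Phi> t u"] \<Psi>[of u "t - \<sigma> n"]
        exp_dominated.bound[OF dom, of u t] that by (simp add: distrib_right)
    have "(\<lambda>n. norm (\<Psi> (t - \<sigma> n) u - \<Phi> t u)) \<longlonglongrightarrow> 0" if "u \<in> {..0}" for u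
      using aa_alongD(2)[OF aa[of u], of t] that
      by (simp add: LIM_zero_iff tendsto_norm_zero_iff)
    from dominated_convergence(2)[OF int exp_integrable_atMost_0[OF rate] bound this]
    have "(\<lambda>n. integral {..0} (\<lambda>u. norm (\<Psi> (t - \<sigma> n) u - \<Phi> t u))) \<longlonglongrightarrow> 0" by simp
    then have "(\<lambda>n. norm (w (t - \<sigma> n) - integral {..0} (\<Phi> t))) \<longlonglongrightarrow> 0"
      by (rule tendsto_sandwich[OF _ _ tendsto_const, rotated 2]) (use dist in auto)
    then show ?thesis by (simp add: LIM_zero_iff tendsto_norm_zero_iff)
  qed
  with w show ?thesis by (auto simp: aa_along_def)
qed

section \<open>Extraction of subsequences for the nonlinearity and the evolution family\<close>

lemma aa_along_subseq:
  assumes "aa_along \<sigma> x y" "strict_mono r"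
  shows "aa_along (\<sigma> \<circ> r) x y"
  unfolding aa_along_def
proof (intro allI conjI)
  fix t
  show "(\<lambda>n. x (t + (\<sigma> \<circ> r) n)) \<longlonglongrightarrow> y t"
    using LIMSEQ_subseq_LIMSEQ[OF aa_alongD(1)[OF assms(1)] assms(2)] by (simp add: o_def)
  show "(\<lambda>n. y (t - (\<sigma> \<circ> r) n)) \<longlonglongrightarrow> x t"
    using LIMSEQ_subseq_LIMSEQ[OF aa_alongD(2)[OF assms(1)] assms(2)] by (simp add: o_def)
qed

lemma AA_param_subseq:
  assumes "f \<in> AA_param" "bounded B"
  obtains r g where "strict_mono (r :: nat \<Rightarrow> nat)"
    and "\<And>z. z \<in> B \<Longrightarrow> aa_along (\<sigma> \<circ> r) (\<lambda>t. f t z) (\<lambda>t. g t z)"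
proof -
  have "\<exists>r g. strict_mono (r :: nat \<Rightarrow> nat) \<and>
      (\<forall>t. uniform_limit B (\<lambda>n x. f (t + \<sigma> (r n)) x) (g t) sequentially \<and>
           uniform_limit B (\<lambda>n x. g (t - \<sigma> (r n)) x) (f t) sequentially)"
    using assms by (simp add: AA_param_def)
  then obtain r g where r: "strict_mono r"
    and rg: "\<forall>t. uniform_limit B (\<lambda>n x. f (t + \<sigma> (r n)) x) (g t) sequentially \<and>
           uniform_limit B (\<lambda>n x. g (t - \<sigma> (r n)) x) (f t) sequentially"
    by (elim exE conjE)
  have "aa_along (\<sigma> \<circ> r) (\<lambda>t. f t z) (\<lambda>t. g t z)" if "z \<in> B" for z
    unfolding aa_along_def o_def
    by (intro allI conjI; rule tendsto_uniform_limitI[OF _ that]; use rg in simp)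
  with r show thesis by (rule that)
qed

text \<open>Both arguments of \<open>U\<close> are translated together, so writing
  \<open>s = t + u\<close> turns bi-almost automorphy into a one-parameter property for each fixed
  \<open>u\<close>. This matches the integrand of \<open>conv\<close> after the shift to
  \<open>{..0}\<close>.\<close>

definition biaa_along :: "(nat \<Rightarrow> real) \<Rightarrow> 'a set \<Rightarrow>
    (real \<Rightarrow> real \<Rightarrow> 'a \<Rightarrow> 'a::metric_space) \<Rightarrow> (real \<Rightarrow> real \<Rightarrow> 'a \<Rightarrow> 'a) \<Rightarrow> bool" where
  "biaa_along \<sigma> B U V \<longleftrightarrow> (\<forall>u\<le>0. \<forall>z\<in>B. aa_along \<sigma> (\<lambda>t. U t (t + u) z) (\<lambda>t. V t (t + u) z))"

lemma bi_AA_subseq: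
  assumes "bi_AA_on_bounded U" "bounded B"
  obtains r V where "strict_mono (r :: nat \<Rightarrow> nat)" and "biaa_along (\<sigma> \<circ> r) B U V"
proof -
  have "\<exists>r V. strict_mono (r :: nat \<Rightarrow> nat) \<and> (\<forall>t s. s \<le> t \<longrightarrow>
      uniform_limit B (\<lambda>n x. U (t + \<sigma> (r n)) (s + \<sigma> (r n)) x) (V t s) sequentially \<and>
      uniform_limit B (\<lambda>n x. V (t - \<sigma> (r n)) (s - \<sigma> (r n)) x) (U t s) sequentially)"
    using assms by (simp add: bi_AA_on_bounded_def)
  then obtain r V where r: "strict_mono r" and rV: "\<forall>t s. s \<le> t \<longrightarrow>
      uniform_limit B (\<lambda>n x. U (t + \<sigma> (r n)) (s + \<sigma> (r n)) x) (V t s) sequentially \<and>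
      uniform_limit B (\<lambda>n x. V (t - \<sigma> (r n)) (s - \<sigma> (r n)) x) (U t s) sequentially"
    by (elim exE conjE)
  have "biaa_along (\<sigma> \<circ> r) B U V"
    unfolding biaa_along_def aa_along_def
  proof (intro allI impI ballI conjI)
    fix u :: real and z t assume "u \<le> 0" and z: "z \<in> B"
    then have "t + u \<le> t" by simp
    with rV have "uniform_limit B (\<lambda>n x. U (t + \<sigma> (r n)) (t + u + \<sigma> (r n)) x) (V t (t + u)) sequentially"
      "uniform_limit B (\<lambda>n x. V (t - \<sigma> (r n)) (t + u - \<sigma> (r n)) x) (U t (t + u)) sequentially"
      by blast+
    from this[THEN tendsto_uniform_limitI, OF z] show "(\<lambda>n. U (t + (\<sigma> \<circ> r) n) (t + (\<sigma> \<circ> r) n + u) z) \<longlonglongrightarrow> V t (t + u) z"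
      "(\<lambda>n. V (t - (\<sigma> \<circ> r) n) (t - (\<sigma> \<circ> r) n + u) z) \<longlonglongrightarrow> U t (t + u) z"
      by (simp_all add: algebra_simps)
  qed
  with r show thesis by (rule that)
qed

section \<open>Exponentially stable evolution families\<close>

locale exp_stable_family =
  fixes U :: "real \<Rightarrow> real \<Rightarrow> 'a::complex_banach \<Rightarrow> 'a" and M \<delta> :: real
  assumes evolution: "evolution_family U" and M_pos: "0 < M" and \<delta>_pos: "0 < \<delta>"
    and onorm_U: "\<And>t s. s \<le> t \<Longrightarrow> onorm (U t s) \<le> M * exp (- \<delta> * (t - s))"
begin

lemma bounded_linear_U: "s \<le> t \<Longrightarrow> bounded_linear (U t s)"
  using evolution by (auto simp: evolution_family_def bounded_clinear_def)

lemma norm_U: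
  assumes "s \<le> t"
  shows "norm (U t s x) \<le> M * exp (\<delta> * (s - t)) * norm x"
proof -
  have "norm (U t s x) \<le> onorm (U t s) * norm x"
    by (rule onorm[OF bounded_linear_U[OF assms]])
  also have "\<dots> \<le> M * exp (- \<delta> * (t - s)) * norm x"
    by (intro mult_right_mono onorm_U assms norm_ge_zero)
  finally show ?thesis by (simp add: algebra_simps)
qed

lemma lipschitz_U:
  assumes "s \<le> t"
  shows "M-lipschitz_on B (U t s)"
proof (rule lipschitz_onI)
  fix x y
  have "norm (U t s (x - y)) \<le> M * exp (\<delta> * (s - t)) * norm (x - y)"
    by (rule norm_U[OF assms])
  also have "\<dots> \<le> M * 1 * norm (x - y)"
    using assms M_pos \<delta>_pos by (intro mult_right_mono mult_left_mono) (auto simp: mult_le_0_iff)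
  finally show "dist (U t s x) (U t s y) \<le> M * dist x y"
    by (simp add: dist_norm linear_diff[OF bounded_linear.linear[OF bounded_linear_U[OF assms]]])
qed (use M_pos in simp)

text \<open>Strong continuity concerns a fixed vector; the uniform Lipschitz constant
  \<open>M\<close> of the operators extends it to the moving vector \<open>h s\<close>.\<close>

lemma continuous_U_comp:
  assumes "continuous_on UNIV h"
  shows "continuous_on {(t, s). s \<le> t} (\<lambda>(t, s). U t s (h s))"
  unfolding continuous_on_sequentially
proof (intro allI ballI impI, elim conjE)
  fix p :: "nat \<Rightarrow> real \<times> real" and q
  assume q: "q \<in> {(t, s). s \<le> t}" and p: "\<forall>n. p n \<in> {(t, s). s \<le> t}" "p \<longlonglongrightarrow> q"
  have "continuous_on {(t, s). s \<le> t} (\<lambda>(t, s). U t s x)" for x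
    using evolution by (auto simp: evolution_family_def)
  from continuous_on_tendsto_compose[OF this p(2) q]
  have U: "(\<lambda>n. U (fst (p n)) (snd (p n)) x) \<longlonglongrightarrow> U (fst q) (snd q) x" for x
    using p(1) by (simp add: case_prod_unfold)
  have "isCont h (snd q)"
    using assms by (simp add: continuous_on_eq_continuous_at)
  then have h: "(\<lambda>n. h (snd (p n))) \<longlonglongrightarrow> h (snd q)"
    by (rule isCont_tendsto_compose) (intro tendsto_intros p)
  have "(\<lambda>n. U (fst (p n)) (snd (p n)) (h (snd (p n)))) \<longlonglongrightarrow> U (fst q) (snd q) (h (snd q))"
    by (rule lipschitz_on_tendsto_comp[OF lipschitz_U[where B = UNIV] U h]) (use p(1) in \<open>auto simp: case_prod_unfold\<close>)
  then show "((\<lambda>(t, s). U t s (h s)) \<circ> p) \<longlonglongrightarrow> (case q of (t, s) \<Rightarrow> U t s (h s))"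
    by (simp add: o_def case_prod_unfold)
qed

text \<open>The linear part of \<Gamma>, separated so that its estimates can be proved for an
  arbitrary bounded continuous forcing \<open>h\<close>.\<close>

definition conv :: "(real \<Rightarrow> 'a) \<Rightarrow> real \<Rightarrow> 'a" where
  "conv h t = integral {..t} (\<lambda>s. U t s (h s))"

context
  fixes h :: "real \<Rightarrow> 'a" and K :: real
  assumes h: "continuous_on UNIV h" "\<And>s. norm (h s) \<le> K"
begin

lemma dominated: "exp_dominated (\<lambda>s. U t s (h s)) (M * K) \<delta> t"
proof
  show "continuous_on {..t} (\<lambda>s. U t s (h s))"
  proof -
    have "continuous_on {..t} (\<lambda>s. (t, s))" by (intro continuous_intros)
    from continuous_on_compose2[OF continuous_U_comp[OF h(1)] this] show ?thesis by auto
  qed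
  show "norm (U t s (h s)) \<le> M * K * exp (\<delta> * (s - t))" if "s \<le> t" for s
  proof -
    have "norm (U t s (h s)) \<le> M * exp (\<delta> * (s - t)) * norm (h s)"
      by (rule norm_U[OF that])
    also have "\<dots> \<le> M * exp (\<delta> * (s - t)) * K"
      using M_pos by (intro mult_left_mono h) auto
    finally show ?thesis by (simp add: mult_ac)
  qed
qed (rule \<delta>_pos)

lemma dominated_shift: "exp_dominated (\<lambda>u. U t (t + u) (h (t + u))) (M * K) \<delta> 0"
  by (rule exp_dominated.shift_exp_dominated[OF dominated])

lemma conv_shift: "conv h t = integral {..0} (\<lambda>u. U t (t + u) (h (t + u)))"
  unfolding conv_def by (rule exp_dominated.integral_atMost_shift[OF dominated])

lemma norm_conv: "norm (conv h t) \<le> M * K / \<delta>"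
  unfolding conv_def by (rule exp_dominated.norm_integral_atMost[OF dominated])

text \<open>After the shift the domain is fixed and the integrands converge pointwise under a common
  majorant.\<close>

lemma continuous_conv: "continuous_on UNIV (conv h)"
  unfolding continuous_on_sequentially
proof (intro allI ballI impI, elim conjE)
  fix x :: "nat \<Rightarrow> real" and t assume x: "x \<longlonglongrightarrow> t"
  have "(\<lambda>n. U (x n) (x n + u) (h (x n + u))) \<longlonglongrightarrow> U t (t + u) (h (t + u))" if "u \<le> 0" for u
  proof -
    have "(\<lambda>n. (x n, x n + u)) \<longlonglongrightarrow> (t, t + u)"
      by (intro tendsto_intros x)
    from continuous_on_tendsto_compose[OF continuous_U_comp[OF h(1)] this] that show ?thesis by simp
  qed
  then show "(conv h \<circ> x) \<longlonglongrightarrow> conv h t"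
    unfolding o_def conv_shift
    by (rule exp_dominated_integral_tendsto[OF dominated_shift dominated_shift])
qed

text \<open>The bounded operator \<open>U t a\<close> passes under the integral over
  \<open>{..a}\<close>, and the evolution law turns \<open>U t a (U a s z)\<close> into
  \<open>U t s z\<close>. With \<open>conv h = x\<close> this is the mild solution formula.\<close>

lemma conv_split:
  assumes "a \<le> t"
  shows "conv h t = U t a (conv h a) + integral {a..t} (\<lambda>s. U t s (h s))"
    and "(\<lambda>s. U t s (h s)) integrable_on {a..t}"
proof -
  note split = exp_dominated.integral_atMost_split[OF dominated assms]
  show "(\<lambda>s. U t s (h s)) integrable_on {a..t}"
    by (rule split(3))
  have "U t a (conv h a) = integral {..a} (U t a \<circ> (\<lambda>s. U a s (h s)))"
    unfolding conv_def
    by (intro integral_linear[symmetric] exp_dominated.integrable_atMost[OF dominated]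
        bounded_linear_U assms)
  also have "\<dots> = integral {..a} (\<lambda>s. U t s (h s))"
    using evolution assms by (intro integral_cong) (auto simp: evolution_family_def)
  finally show "conv h t = U t a (conv h a) + integral {a..t} (\<lambda>s. U t s (h s))"
    unfolding conv_def using split(1) by simp
qed

text \<open>Uniqueness for the linear problem: \<open>x\<close> and \<open>h\<close> are kept
  independent, and the nonlinear equation enters later through the choice of \<open>h\<close>. The
  proof lets \<open>a = t - n\<close> tend to minus infinity.\<close>

lemma bounded_solution_eq_conv:
  assumes bounded: "\<And>s. norm (x s) \<le> X"
    and x: "\<And>a. a \<le> t \<Longrightarrow> x t = U t a (x a) + integral {a..t} (\<lambda>s. U t s (h s))"
  shows "x t = conv h t"
proof -
  interpret exp_dominated "\<lambda>s. U t s (h s)" "M * K" \<delta> t by (rule dominated)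
  have lim: "(\<lambda>n. M * X * exp (- \<delta>) ^ n) \<longlonglongrightarrow> 0"
    using \<delta>_pos by (intro tendsto_mult_right_zero LIMSEQ_realpow_zero) auto
  have "norm (U t (t - real n) (x (t - real n))) \<le> M * X * exp (- \<delta>) ^ n" for n
  proof -
    have "norm (U t (t - real n) (x (t - real n))) \<le> M * exp (- \<delta> * real n) * norm (x (t - real n))"
      using norm_U[of "t - real n" t] by simp
    also have "\<dots> \<le> M * exp (- \<delta> * real n) * X"
      using M_pos by (intro mult_left_mono bounded) auto
    also have "exp (- \<delta> * real n) = exp (- \<delta>) ^ n"
      by (simp add: exp_of_nat_mult[symmetric] mult.commute)
    finally show ?thesis by (simp add: mult_ac)
  qed
  then have "(\<lambda>n. U t (t - real n) (x (t - real n))) \<longlonglongrightarrow> 0"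
    by (intro Lim_null_comparison[OF _ lim] always_eventually allI)
  from tendsto_add[OF this integral_atMost_LIMSEQ]
  have "(\<lambda>n. U t (t - real n) (x (t - real n)) + integral {t - real n..t} (\<lambda>s. U t s (h s))) \<longlonglongrightarrow> conv h t"
    by (simp add: conv_def)
  moreover have "U t (t - real n) (x (t - real n)) + integral {t - real n..t} (\<lambda>s. U t s (h s)) = x t" for n
    by (rule x[symmetric]) simp
  ultimately have "(\<lambda>n. x t) \<longlonglongrightarrow> conv h t" by simp
  then show ?thesis by (simp add: LIMSEQ_const_iff)
qed

lemma aa_along_conv:
  assumes "aa_along \<sigma> h k" and "biaa_along \<sigma> (cball 0 K) U V"
  shows "\<exists>w. aa_along \<sigma> (conv h) w"
proof -
  have "aa_along \<sigma> (\<lambda>t. U t (t + u) (h (t + u))) (\<lambda>t. V t (t + u) (k (t + u)))" if "u \<le> 0" for u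
    by (rule aa_along_comp[OF assms(1), where B = "cball 0 K" and C = M])
      (use assms(2) that h in \<open>auto simp: biaa_along_def intro: lipschitz_U\<close>)
  then have "\<exists>w. aa_along \<sigma> (\<lambda>t. integral {..0} (\<lambda>u. U t (t + u) (h (t + u)))) w"
    by (rule aa_along_integral[OF dominated_shift])
  then show ?thesis by (simp add: conv_shift[abs_def])
qed

end

text \<open>Linearity reduces this to \<open>norm_conv\<close> for the forcing \<open>h - k\<close>,
  which is bounded by \<open>e\<close>.\<close>

lemma norm_conv_diff:
  assumes h: "continuous_on UNIV h" "\<And>s. norm (h s) \<le> K"
    and k: "continuous_on UNIV k" "\<And>s. norm (k s) \<le> K"
    and e: "\<And>s. norm (h s - k s) \<le> e"
  shows "norm (conv h t - conv k t) \<le> M * e / \<delta>"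
proof -
  have "conv h t - conv k t = integral {..t} (\<lambda>s. U t s (h s) - U t s (k s))"
    unfolding conv_def
    by (intro Henstock_Kurzweil_Integration.integral_diff[symmetric]
        exp_dominated.integrable_atMost[OF dominated[OF h]] exp_dominated.integrable_atMost[OF dominated[OF k]])
  also have "\<dots> = conv (\<lambda>s. h s - k s) t"
    unfolding conv_def
    by (intro integral_cong)
      (simp add: linear_diff[OF bounded_linear.linear[OF bounded_linear_U]])
  finally show ?thesis
    using norm_conv[of "\<lambda>s. h s - k s" e t] h k e by (simp add: continuous_on_diff)
qed

end

section \<open>The delay equation\<close>

locale stable_delay_equation = exp_stable_family U M \<delta>
  for U :: "real \<Rightarrow> real \<Rightarrow> 'a::complex_banach \<Rightarrow> 'a" and M \<delta> :: real +
  fixes f :: "real \<Rightarrow> 'a \<Rightarrow> 'a" and \<tau> L K :: real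
  assumes f_cont: "continuous_on UNIV (\<lambda>(t, x). f t x)"
    and f_bound: "\<And>t x. norm (f t x) \<le> K"
    and f_lipschitz: "\<And>t. L-lipschitz_on UNIV (f t)"
begin

abbreviation forcing :: "(real \<Rightarrow> 'a) \<Rightarrow> real \<Rightarrow> 'a" where
  "forcing x s \<equiv> f s (x (s - \<tau>))"

lemma Gamma_op_eq_conv: "Gamma_op U f \<tau> x = conv (forcing x)"
  by (simp add: fun_eq_iff Gamma_op_def conv_def)

lemma continuous_forcing:
  assumes "continuous_on UNIV x"
  shows "continuous_on UNIV (forcing x)"
proof -
  have "continuous_on UNIV (\<lambda>s. (s, x (s - \<tau>)))"
    by (intro continuous_intros continuous_on_compose2[OF assms]) auto
  from continuous_on_compose2[OF f_cont this] show ?thesis by simp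
qed

lemma Gamma_op_bcontfun:
  assumes "continuous_on UNIV x"
  shows "Gamma_op U f \<tau> x \<in> bcontfun"
proof (rule bcontfun_normI)
  show "continuous_on UNIV (Gamma_op U f \<tau> x)"
    unfolding Gamma_op_eq_conv by (rule continuous_conv[OF continuous_forcing[OF assms] f_bound])
  show "norm (Gamma_op U f \<tau> x t) \<le> M * K / \<delta>" for t
    unfolding Gamma_op_eq_conv by (rule norm_conv[OF continuous_forcing[OF assms] f_bound])
qed

text \<open>On bounded continuous functions the distance is that of the supremum norm and the space
  is complete, so Banach's theorem is available on the whole type and on its closed subsets.\<close>

definition Gamma_bc :: "(real \<Rightarrow>\<^sub>C 'a) \<Rightarrow> (real \<Rightarrow>\<^sub>C 'a)" where
  "Gamma_bc x = Bcontfun (Gamma_op U f \<tau> x)"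

lemma Gamma_bc_apply: "apply_bcontfun (Gamma_bc x) = conv (forcing x)"
  unfolding Gamma_bc_def Gamma_op_eq_conv[symmetric]
  by (rule Bcontfun_inverse[OF Gamma_op_bcontfun[OF continuous_on_apply_bcontfun]])

text \<open>The delay costs nothing in the supremum distance, so the forcings differ by at most
  \<open>L * dist x y\<close>; \<open>norm_conv_diff\<close> contributes the factor
  \<open>M / \<delta>\<close>.\<close>

lemma Gamma_bc_contraction: "dist (Gamma_bc x) (Gamma_bc y) \<le> M / \<delta> * L * dist x y"
proof (rule dist_bound)
  fix t
  have "norm (forcing x s - forcing y s) \<le> L * dist x y" for s
  proof -
    have "dist (forcing x s) (forcing y s) \<le> L * dist (x (s - \<tau>)) (y (s - \<tau>))"
      by (rule lipschitz_onD[OF f_lipschitz]) auto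
    also have "\<dots> \<le> L * dist x y"
      by (intro mult_left_mono dist_bounded lipschitz_on_nonneg[OF f_lipschitz])
    finally show ?thesis by (simp add: dist_norm)
  qed
  from norm_conv_diff[OF continuous_forcing f_bound continuous_forcing f_bound this, of t]
  show "dist (Gamma_bc x t) (Gamma_bc y t) \<le> M / \<delta> * L * dist x y"
    by (simp add: Gamma_bc_apply dist_norm mult_ac)
qed

text \<open>One direction is \<open>conv_split\<close>, the other
  \<open>bounded_solution_eq_conv\<close>, both with \<open>h\<close> the forcing of
  \<open>x\<close>.\<close>

lemma Gamma_bc_fixed_point_iff:
  "Gamma_bc x = x \<longleftrightarrow> mild_solution U f \<tau> (apply_bcontfun x)"
proof
  assume fix_x: "Gamma_bc x = x"
  have eq: "apply_bcontfun x = conv (forcing x)"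
    by (subst fix_x[symmetric]) (rule Gamma_bc_apply)
  show "mild_solution U f \<tau> (apply_bcontfun x)"
    unfolding mild_solution_def
  proof (intro conjI allI impI)
    fix a t :: real assume "a \<le> t"
    note split = conv_split[OF continuous_forcing[OF continuous_on_apply_bcontfun] f_bound this, of x]
    show "(\<lambda>s. U t s (forcing x s)) integrable_on {a..t}" by (rule split(2))
    show "apply_bcontfun x t = U t a (apply_bcontfun x a) + integral {a..t} (\<lambda>s. U t s (forcing x s))"
      using split(1) by (simp flip: eq)
  qed simp
next
  assume mild: "mild_solution U f \<tau> (apply_bcontfun x)"
  obtain X where "\<And>s. norm (apply_bcontfun x s) \<le> X"
    using bounded_apply_bcontfun[of x] by (auto simp: bounded_iff)
  then have "conv (forcing x) t = apply_bcontfun x t" for t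
    using mild unfolding mild_solution_def
    by (intro bounded_solution_eq_conv[OF continuous_forcing f_bound, symmetric]) auto
  then show "Gamma_bc x = x"
    by (intro bcontfun_eqI) (simp add: Gamma_bc_apply)
qed

text \<open>The radius is the a priori bound on all values of \<Gamma>. It confines the arguments of
  \<open>f\<close> to one ball, for which a subsequence can be chosen before the fixed point is
  known.\<close>

definition aa_ball :: "(nat \<Rightarrow> real) \<Rightarrow> (real \<Rightarrow>\<^sub>C 'a) set" where
  "aa_ball \<sigma> = {x. (\<exists>w. aa_along \<sigma> (apply_bcontfun x) w) \<and> (\<forall>t. norm (apply_bcontfun x t) \<le> M * K / \<delta>)}"

lemma closed_aa_ball: "closed (aa_ball \<sigma>)"
  unfolding closed_sequential_limits
proof (intro allI impI, elim conjE)
  fix x l assume x: "\<forall>n. x n \<in> aa_ball \<sigma>" "x \<longlonglongrightarrow> l"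
  have unif: "uniform_limit UNIV (\<lambda>n. apply_bcontfun (x n)) (apply_bcontfun l) sequentially"
    by (rule tendsto_bcontfun_uniform_limit[OF x(2)])
  from x(1) obtain w where "\<And>n. aa_along \<sigma> (apply_bcontfun (x n)) (w n)"
    unfolding aa_ball_def by simp metis
  then have "\<exists>w. aa_along \<sigma> (apply_bcontfun l) w"
    by (rule aa_along_uniform_limit[OF _ unif])
  moreover have "norm (apply_bcontfun l t) \<le> M * K / \<delta>" for t
    using x(1) by (intro LIMSEQ_le_const2[OF tendsto_norm[OF tendsto_uniform_limitI[OF unif]]])
      (auto simp: aa_ball_def)
  ultimately show "l \<in> aa_ball \<sigma>" by (simp add: aa_ball_def)
qed

text \<open>Two balls occur: \<open>f\<close> acts on values of \<open>x\<close>, bounded by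
  \<open>M * K / \<delta>\<close>, and \<open>U\<close> acts on values of \<open>f\<close>, bounded
  by \<open>K\<close>.\<close>

lemma Gamma_bc_aa_ball:
  assumes f: "\<And>z. z \<in> cball 0 (M * K / \<delta>) \<Longrightarrow> aa_along \<sigma> (\<lambda>t. f t z) (\<lambda>t. g t z)"
    and U: "biaa_along \<sigma> (cball 0 K) U V" and x: "x \<in> aa_ball \<sigma>"
  shows "Gamma_bc x \<in> aa_ball \<sigma>"
proof -
  obtain w where w: "aa_along \<sigma> (apply_bcontfun x) w"
    using x by (auto simp: aa_ball_def)
  \<comment> \<open>The delay is written as a translation by \<open>- \<tau>\<close> to fit
    \<open>aa_along_comp\<close>.\<close>
  have "aa_along \<sigma> (\<lambda>t. f t (x (t + - \<tau>))) (\<lambda>t. g t (w (t + - \<tau>)))"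
    by (rule aa_along_comp[OF w, where B = "cball 0 (M * K / \<delta>)" and C = L])
      (use x f in \<open>auto simp: aa_ball_def intro: lipschitz_on_subset[OF f_lipschitz]\<close>)
  then have "\<exists>w. aa_along \<sigma> (conv (forcing x)) w"
    by (intro aa_along_conv[OF continuous_forcing f_bound _ U]) auto
  moreover have "norm (conv (forcing x) t) \<le> M * K / \<delta>" for t
    by (intro norm_conv continuous_forcing f_bound) auto
  ultimately show ?thesis by (simp add: aa_ball_def Gamma_bc_apply)
qed

lemma zero_in_aa_ball: "0 \<in> aa_ball \<sigma>"
proof -
  have "0 \<le> K" using order_trans[OF norm_ge_zero f_bound] .
  then show ?thesis
    using M_pos \<delta>_pos by (auto simp: aa_ball_def aa_along_def intro!: exI[of _ "\<lambda>_. 0"])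
qed

lemma fixed_point_AA:
  assumes "M / \<delta> * L < 1" "f \<in> AA_param" "bi_AA_on_bounded U" and x: "Gamma_bc x = x"
  shows "apply_bcontfun x \<in> AA"
  unfolding AA_altdef
proof (intro conjI allI)
  fix \<sigma> :: "nat \<Rightarrow> real"
  have c: "0 \<le> M / \<delta> * L"
    using M_pos \<delta>_pos lipschitz_on_nonneg[OF f_lipschitz] by simp
  \<comment> \<open>A first subsequence serves \<open>f\<close>; it is then thinned for
    \<open>U\<close>, and \<open>aa_along_subseq\<close> preserves the property of
    \<open>f\<close>.\<close>
  obtain r1 :: "nat \<Rightarrow> nat" and g where r1: "strict_mono r1"
    and g: "\<And>z. z \<in> cball 0 (M * K / \<delta>) \<Longrightarrow> aa_along (\<sigma> \<circ> r1) (\<lambda>t. f t z) (\<lambda>t. g t z)"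
    using AA_param_subseq[OF assms(2) bounded_cball] by metis
  obtain r2 :: "nat \<Rightarrow> nat" and V where r2: "strict_mono r2"
    and V: "biaa_along (\<sigma> \<circ> r1 \<circ> r2) (cball 0 K) U V"
    using bi_AA_subseq[OF assms(3) bounded_cball] by metis
  let ?S = "aa_ball (\<sigma> \<circ> r1 \<circ> r2)"
  have "\<exists>!y\<in>?S. Gamma_bc y = y"
  proof (rule Banach_fix[OF _ _ c assms(1)])
    show "complete ?S" by (simp add: complete_eq_closed closed_aa_ball)
    show "Gamma_bc ` ?S \<subseteq> ?S"
      using Gamma_bc_aa_ball[OF aa_along_subseq[OF g r2] V] by blast
  qed (use zero_in_aa_ball Gamma_bc_contraction in auto)
  then obtain y where y: "y \<in> ?S" "Gamma_bc y = y" by blast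
  \<comment> \<open>The fixed point found in \<open>?S\<close> is the given one, by uniqueness on
    the whole space.\<close>
  have "y = x"
    using banach_fix_type[OF c assms(1), of Gamma_bc] Gamma_bc_contraction x y(2) by metis
  then obtain w where "aa_along (\<sigma> \<circ> (r1 \<circ> r2)) (apply_bcontfun x) w"
    using y(1) by (auto simp: aa_ball_def o_assoc)
  then show "\<exists>r y. strict_mono (r :: nat \<Rightarrow> nat) \<and> aa_along (\<sigma> \<circ> r) (apply_bcontfun x) y"
    using strict_mono_o[OF r1 r2] by blast
qed auto

end

section \<open>Existence and uniqueness in the prescribed ball\<close>

lemma sup_norm_diff_bcontfun:
  "sup_norm (\<lambda>t. apply_bcontfun x t - apply_bcontfun y t) = dist x y"
  by (simp add: sup_norm_def dist_bcontfun.rep_eq dist_norm)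

theorem theorem6p3:
  fixes D :: "real \<Rightarrow> 'a::complex_banach set"
    and A :: "real \<Rightarrow> 'a \<Rightarrow> 'a"
    and U :: "real \<Rightarrow> real \<Rightarrow> 'a \<Rightarrow> 'a"
    and f :: "real \<Rightarrow> 'a \<Rightarrow> 'a"
    and x\<^sub>0 :: "real \<Rightarrow> 'a"
    and \<tau> M \<delta> L \<rho> \<theta> :: real
  assumes "0 < \<tau>"
    and "acquistapace_terreni D A"
    and "evolution_family U" and "governs_equation U D A"
    and "bi_AA_on_bounded U"
    and "0 < M" and "0 < \<delta>"
    and "\<And>t s. s \<le> t \<Longrightarrow> onorm (U t s) \<le> M * exp (- \<delta> * (t - s))"
    and "f \<in> AA_param"
    and "\<And>t. L-lipschitz_on UNIV (f t)"
    and "0 < \<rho>"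
    and "x\<^sub>0 = center_fun U f"
    and "\<theta> = inverse (1 - M / \<delta> * L) * sup_norm (\<lambda>t. Gamma_op U f \<tau> x\<^sub>0 t - x\<^sub>0 t)"
    and "0 < \<theta>" and "\<theta> \<le> \<rho>"
  shows "\<exists>!x. x \<in> AA \<and> mild_solution U f \<tau> x \<and> sup_norm (\<lambda>t. x t - x\<^sub>0 t) \<le> \<rho>"
proof -
  have f: "continuous_on UNIV (\<lambda>(t, x). f t x)" "bounded (range (\<lambda>(t, x). f t x))"
    using \<open>f \<in> AA_param\<close> by (simp_all add: AA_param_def)
  obtain K where "\<forall>p\<in>range (\<lambda>(t, x). f t x). norm p \<le> K"
    using f(2) unfolding bounded_iff by blast
  then have K: "norm (f t x) \<le> K" for t x by fast
  interpret stable_delay_equation U M \<delta> f \<tau> L K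
    by unfold_locales (rule assms(3,6,7,8,10) f(1) K; assumption?)+
  let ?c = "M / \<delta> * L"
  \<comment> \<open>The centre is \<Gamma> applied to the zero function, hence bounded and
    continuous.\<close>
  have x\<^sub>0: "x\<^sub>0 = Gamma_op U f \<tau> (\<lambda>_. 0)"
    unfolding \<open>x\<^sub>0 = center_fun U f\<close> by (simp add: fun_eq_iff Gamma_op_def center_fun_def)
  then have "x\<^sub>0 \<in> bcontfun"
    using Gamma_op_bcontfun by simp
  then obtain b where b: "x\<^sub>0 = apply_bcontfun b" by (rule bcontfunE)
  have \<theta>: "\<theta> = inverse (1 - ?c) * dist (Gamma_bc b) b"
    using assms(13) by (simp add: b Gamma_op_eq_conv Gamma_bc_apply[symmetric] sup_norm_diff_bcontfun)
  \<comment> \<open>For \<open>?c \<ge> 1\<close> the inverse is at most 0, with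
    \<open>inverse 0 = 0\<close> covering equality, and \<theta> could not be positive.\<close>
  have c1: "?c < 1"
    using \<open>0 < \<theta>\<close> unfolding \<theta> by (auto simp: zero_less_mult_iff)
  have c0: "0 \<le> ?c"
    using M_pos \<delta>_pos lipschitz_on_nonneg[OF f_lipschitz] by simp
  have fix_unique: "\<exists>!x. Gamma_bc x = x"
    using Gamma_bc_contraction by (intro banach_fix_type[OF c0 c1]) auto
  then obtain x where x: "Gamma_bc x = x" by blast
  have "dist x b \<le> dist (Gamma_bc x) (Gamma_bc b) + dist (Gamma_bc b) b"
    using dist_triangle[of "Gamma_bc x" b "Gamma_bc b"] x by simp
  also have "\<dots> \<le> ?c * dist x b + dist (Gamma_bc b) b"
    using Gamma_bc_contraction by simp
  finally have "dist x b * (1 - ?c) \<le> dist (Gamma_bc b) b"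
    by (simp add: right_diff_distrib mult.commute)
  then have "dist x b \<le> \<theta>"
    using c1 by (simp add: \<theta> pos_le_divide_eq flip: divide_inverse_commute)
  then have "sup_norm (\<lambda>t. apply_bcontfun x t - x\<^sub>0 t) \<le> \<rho>"
    using \<open>\<theta> \<le> \<rho>\<close> by (simp add: b sup_norm_diff_bcontfun)
  moreover have "apply_bcontfun x \<in> AA"
    by (rule fixed_point_AA[OF c1 \<open>f \<in> AA_param\<close> \<open>bi_AA_on_bounded U\<close> x])
  moreover have "mild_solution U f \<tau> (apply_bcontfun x)"
    using x by (simp add: Gamma_bc_fixed_point_iff)
  \<comment> \<open>Membership in \<open>AA\<close> includes boundedness, so every such mild
    solution is a fixed point of \<open>Gamma_bc\<close>.\<close>
  moreover have "y = apply_bcontfun x" if "y \<in> AA" "mild_solution U f \<tau> y" for y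
  proof -
    have "y \<in> bcontfun" using that(1) by (simp add: AA_def bcontfun_def)
    then obtain z where z: "y = apply_bcontfun z" by (rule bcontfunE)
    then have "Gamma_bc z = z" using that(2) by (simp add: Gamma_bc_fixed_point_iff)
    with x fix_unique z show ?thesis by blast
  qed
  ultimately show ?thesis by blast
qed

end
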